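(* Let $D$ be a principal ideal domain with quotient field $K$, and let $f\in\operatorname{Int}(D)=\{f\in K[x]\mid f(D)\subseteq D\}$ be a non-constant image-primitive integer-valued polynomial, written in standard form as $f=g/b$ with $b\in D\setminus\{0\}$ and $g=\prod_{i\in I}g_i$, where $I$ is a finite set and each $g_i$ is primitive and irreducible in $D[x]$. If the essential graph of $(g_i\mid i\in I)$ is connected, then $f$ is irreducible in $\operatorname{Int}(D)$.
   Context: A polynomial in $D[x]$ is primitive if the greatest common divisor of its coefficients is $1$. Standard form: a non-zero $f\in K[x]$ is written as $f=\frac{a\prod_{i\in I}g_i}{b}$ with $a,b\in D\setminus\{0\}$, $\gcd(a,b)=1$, $I$ a finite set, and each $g_i$ primitive and irreducible in $D[x]$ (the $g_i$ need not be distinct for distinct indices); $a$, $b$ and the numerator are unique only up to units of $D$, and for image-primitive $f$ one may take $a=1$. Fixed divisor: for $f\in\operatorname{Int}(D)$, $\mathsf d(f)$ is the ideal of $D$ generated by $f(D)$ (also identified with a generator of this ideal). $f\in\operatorname{Int}(D)$ is image-primitive if $\mathsf d(f)=D$. Essential: let $I\neq\emptyset$ be finite, $g_i\in D[x]$ ($i\in I$) non-constant and primitive, $g=\prod_{i\in I}g_i$, and $p\in D$ a prime element. $g_i$ is essential for $p$ among the $g_j$ with $j\in I$ if $p\mid\mathsf d(g)$ and there exists $w\in D$ such that $v_p(g_i(w))>0$ and $v_p(g_j(w))=0$ for all $j\in I\setminus\{i\}$, where $v_p$ is the $p$-adic valuation. Essential graph: for $g_i\in D[x]$ ($i\in I$)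 primitive and irreducible, the essential graph of $(g_i\mid i\in I)$ is the simple undirected graph with vertex set $I$ in which two (distinct) vertices $i,j$ are joined by an edge if and only if there is a prime element $p\in D$ such that both $g_i$ and $g_j$ are essential for $p$ among the $g_k$ with $k\in I$. An element of a commutative ring is irreducible if it is a non-zero non-unit that is not a product of two non-units. *)

theory Defs
  imports
    "HOL-Computational_Algebra.Polynomial_Factorial"
    "HOL-Library.Extended_Nat"
    "Berlekamp_Zassenhaus.Unique_Factorization"
    "Graph_Theory.Digraph_Component"
begin

context comm_ring_1
begin

definition is_ideal :: "'a set \<Rightarrow> bool"
  where "is_ideal J \<longleftrightarrow>
    0 \<in> J \<and> (\<forall>x\<in>J. \<forall>y\<in>J. x + y \<in> J) \<and> (\<forall>r. \<forall>x\<in>J. r * x \<in> J)"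

definition ideal_generated :: "'a set \<Rightarrow> 'a set"
  where "ideal_generated S = is_ideal hull S"

end

class principal_ideal_domain = idom +
  assumes ideal_principal: "is_ideal J \<Longrightarrow> \<exists>a. J = ideal_generated {a}"

definition int_valued :: "'a::idom fract poly set"
  where "int_valued = {f. \<forall>a. poly f (to_fract a) \<in> range to_fract}"

definition fixed_divisor :: "'a::idom fract poly \<Rightarrow> 'a set"
  where "fixed_divisor f = ideal_generated {d. \<exists>a. to_fract d = poly f (to_fract a)}"

definition image_primitive :: "'a::idom fract poly \<Rightarrow> bool"
  where "image_primitive f \<longleftrightarrow> f \<in> int_valued \<and> fixed_divisor f = UNIV"

text \<open>Unlike \<^const>\<open>multiplicity\<close>, this takes the value \<^term>\<open>\<infinity>\<close> at 0.\<close>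

definition valuation :: "'a::comm_semiring_1 \<Rightarrow> 'a \<Rightarrow> enat"
  where "valuation p x = (SUP n \<in> {n. p ^ n dvd x}. enat n)"

text \<open>The first condition says that \<open>p\<close> divides the fixed divisor of the product, an ideal:
  \<open>p\<close> divides a generator of it iff it divides all its elements.\<close>

definition essential :: "'a::idom \<Rightarrow> 'i set \<Rightarrow> ('i \<Rightarrow> 'a poly) \<Rightarrow> 'i \<Rightarrow> bool"
  where "essential p I g i \<longleftrightarrow>
    (\<forall>c \<in> fixed_divisor (fract_poly (\<Prod>j\<in>I. g j)). p dvd c) \<and>
    (\<exists>w. valuation p (poly (g i) w) > 0 \<and>
         (\<forall>j \<in> I - {i}. valuation p (poly (g j) w) = 0))"

text \<open>Undirected graphs are represented as digraphs with a symmetric set of arcs.\<close>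

definition essential_graph :: "'i set \<Rightarrow> ('i \<Rightarrow> 'a::idom poly) \<Rightarrow> 'i pair_pre_digraph"
  where "essential_graph I g =
    \<lparr>pverts = I,
     parcs = {(i, j). i \<in> I \<and> j \<in> I \<and> i \<noteq> j \<and>
                (\<exists>p. prime_elem p \<and> essential p I g i \<and> essential p I g j)}\<rparr>"

text \<open>Units and irreducible elements of a subring \<open>R\<close>; factors and inverses are taken in \<open>R\<close>.\<close>

definition unit_in :: "'a::comm_ring_1 set \<Rightarrow> 'a \<Rightarrow> bool"
  where "unit_in R u \<longleftrightarrow> u \<in> R \<and> (\<exists>v\<in>R. u * v = 1)"

definition irreducible_in :: "'a::comm_ring_1 set \<Rightarrow> 'a \<Rightarrow> bool"
  where "irreducible_in R f \<longleftrightarrow> f \<in> R \<and> f \<noteq> 0 \<and> \<not> unit_in R f \<and>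
    \<not> (\<exists>a\<in>R. \<exists>b\<in>R. f = a * b \<and> \<not> unit_in R a \<and> \<not> unit_in R b)"

end

theory Submission
  imports Defs "Berlekamp_Zassenhaus.Unique_Factorization_Poly"
begin

text \<open>
  Since each \<open>g i\<close> is prime in the polynomial ring over a factorial domain, a factorization
  \<open>f = f1 * f2\<close> splits the index set into \<open>J\<close> and \<open>I - J\<close>, up to constants. Both factors inherit
  image-primitivity, which forces the constants to be \<open>1 / b1\<close> and \<open>1 / b2\<close> with \<open>b1\<close>, \<open>b2\<close> in the
  ring; a factor with an empty index set is therefore a unit. Otherwise connectedness yields an
  edge between \<open>J\<close> and \<open>I - J\<close>, for a prime \<open>p\<close> dividing the fixed divisor of the numerator, hence
  \<open>b1 * b2\<close>. If \<open>p\<close> divides \<open>b1\<close>, it divides all values of the product over \<open>J\<close>, which contradicts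
  essentiality of the endpoint outside \<open>J\<close>; the case of \<open>b2\<close> is symmetric.
\<close>

section \<open>Ideals\<close>

lemma ideal_generated_subset:
  assumes "S \<subseteq> J" and "is_ideal J"
  shows "ideal_generated S \<subseteq> J"
  unfolding ideal_generated_def using assms by (rule hull_minimal)

lemma ideal_generated_superset: "S \<subseteq> ideal_generated S"
  unfolding ideal_generated_def by (rule hull_subset)

lemma is_idealI:
  assumes "0 \<in> J" and "\<And>x y. x \<in> J \<Longrightarrow> y \<in> J \<Longrightarrow> x + y \<in> J" and "\<And>r x. x \<in> J \<Longrightarrow> r * x \<in> J"
  shows "is_ideal J"
  using assms by (simp add: is_ideal_def)

lemma ideal_generated_singleton: "ideal_generated {a} = {x. a dvd x}"
proof
  show "ideal_generated {a} \<subseteq> {x. a dvd x}"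
    by (rule ideal_generated_subset) (auto intro!: is_idealI)
  have *: "r * a \<in> J" if "is_ideal J" "{a} \<subseteq> J" for r J
    using that by (simp add: is_ideal_def)
  show "{x. a dvd x} \<subseteq> ideal_generated {a}"
    by (auto simp: ideal_generated_def hull_def dvd_def mult.commute[of a] intro: *)
qed

lemma ideal_eq_multiples:
  fixes J :: "'a::principal_ideal_domain set"
  assumes "is_ideal J"
  obtains a where "J = {x. a dvd x}"
  using ideal_principal[OF assms] ideal_generated_singleton by metis

lemma is_ideal_Union_chain:
  fixes J :: "nat \<Rightarrow> 'a::comm_ring_1 set"
  assumes "\<And>n. is_ideal (J n)" and "incseq J"
  shows "is_ideal (\<Union>n. J n)"
proof (rule is_idealI)
  show "0 \<in> (\<Union>n. J n)"
    using assms(1) by (auto simp: is_ideal_def)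
next
  fix x y assume "x \<in> (\<Union>n. J n)" "y \<in> (\<Union>n. J n)"
  then obtain m n where "x \<in> J m" "y \<in> J n" by auto
  then have "x \<in> J (max m n)" "y \<in> J (max m n)"
    using monoD[OF assms(2), of m "max m n"] monoD[OF assms(2), of n "max m n"] by auto
  then show "x + y \<in> (\<Union>n. J n)"
    using assms(1)[of "max m n"] unfolding is_ideal_def by blast
next
  fix r x assume "x \<in> (\<Union>n. J n)"
  then obtain n where "x \<in> J n" by auto
  then show "r * x \<in> (\<Union>n. J n)"
    using assms(1)[of n] unfolding is_ideal_def by blast
qed

section \<open>Principal ideal domains are factorial\<close>

text \<open>Noetherian argument: the principal ideals of the \<open>a n\<close> form an ascending
  chain, whose union is an ideal with a single generator. That generator already lies in some member
  of the chain, and from there on the chain is constant.\<close>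

lemma no_infinite_proper_divisor_chain:
  fixes a :: "nat \<Rightarrow> 'a::principal_ideal_domain"
  assumes "\<And>n. a (Suc n) dvd a n"
  shows "\<exists>n. a n dvd a (Suc n)"
proof -
  let ?J = "\<lambda>n. {x. a n dvd x}"
  have "is_ideal (?J n)" for n
    by (auto intro!: is_idealI)
  moreover have "incseq ?J"
    by (rule incseq_SucI) (use assms dvd_trans in auto)
  ultimately have "is_ideal (\<Union>n. ?J n)"
    by (rule is_ideal_Union_chain)
  then obtain d where d: "(\<Union>n. ?J n) = {x. d dvd x}"
    by (rule ideal_eq_multiples)
  then have "d \<in> (\<Union>n. ?J n)" by simp
  then obtain n where "a n dvd d" by auto
  moreover have "a (Suc n) \<in> ?J (Suc n)" by simp
  then have "a (Suc n) \<in> (\<Union>n. ?J n)" by blast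
  then have "d dvd a (Suc n)" unfolding d by simp
  ultimately show ?thesis using dvd_trans by blast
qed

text \<open>Bezout: let \<open>d\<close> generate the ideal spanned by \<open>p\<close> and
  \<open>a\<close>. As a divisor of the irreducible \<open>p\<close>, it is a unit or a multiple of
  \<open>p\<close>. In the first case, multiplying the Bezout identity by \<open>b\<close> gives p |
  b; in the second, p | d | a.\<close>

lemma irreducible_imp_prime_elem_pid:
  fixes p :: "'a::principal_ideal_domain"
  assumes "irreducible p"
  shows "prime_elem p"
proof (rule prime_elemI)
  show "p \<noteq> 0" "\<not> p dvd 1"
    using assms irreducible_not_unit by auto
next
  fix a b assume ab: "p dvd a * b"
  have "is_ideal {r * p + s * a |r s. True}"
  proof (rule is_idealI)
    show "0 \<in> {r * p + s * a |r s. True}"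
      by (auto intro!: exI[of _ 0])
  next
    fix x y assume "x \<in> {r * p + s * a |r s. True}" "y \<in> {r * p + s * a |r s. True}"
    then obtain r s r' s' where "x = r * p + s * a" "y = r' * p + s' * a" by auto
    then have "x + y = (r + r') * p + (s + s') * a" by (simp add: algebra_simps)
    then show "x + y \<in> {r * p + s * a |r s. True}" by auto
  next
    fix t x assume "x \<in> {r * p + s * a |r s. True}"
    then obtain r s where "x = r * p + s * a" by auto
    then have "t * x = (t * r) * p + (t * s) * a" by (simp add: algebra_simps)
    then show "t * x \<in> {r * p + s * a |r s. True}" by auto
  qed
  then obtain d where d: "{r * p + s * a |r s. True} = {x. d dvd x}"
    by (rule ideal_eq_multiples)
  have "p = 1 * p + 0 * a" "a = 0 * p + 1 * a" by auto
  then have "p \<in> {x. d dvd x}" "a \<in> {x. d dvd x}"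
    unfolding d[symmetric] by blast+
  then have dvd: "d dvd p" "d dvd a" by auto
  show "p dvd a \<or> p dvd b"
  proof (cases "d dvd 1")
    case True
    then have "1 \<in> {r * p + s * a |r s. True}" unfolding d by simp
    then obtain r s where rs: "1 = r * p + s * a" by auto
    have "(r * p + s * a) * b = b" by (simp flip: rs)
    then have "b = p * (r * b) + s * (a * b)" by (simp add: algebra_simps)
    moreover have "p dvd p * (r * b) + s * (a * b)"
      by (rule dvd_add[OF dvd_triv_left dvd_mult[OF ab]])
    ultimately show ?thesis by simp
  next
    case False
    with dvd(1) have "p dvd d"
      using assms irreducibleD' by blast
    with dvd(2) show ?thesis using dvd_trans by blast
  qed
qed

text \<open>The two preceding lemmas supply the divisor chain condition and the primeness condition
  for the monoid of non-zero elements; together these characterize factorial monoids.\<close>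

lemma factorial_monoid_pid:
  "factorial_monoid (mk_monoid :: 'a::principal_ideal_domain monoid)"
proof -
  interpret comm_monoid_cancel "mk_monoid :: 'a monoid"
    by unfold_locales (auto simp: ac_simps)
  have "divisor_chain_condition_monoid (mk_monoid :: 'a monoid)"
  proof
    show "wf {(x, y). x \<in> carrier (mk_monoid :: 'a monoid) \<and> y \<in> carrier mk_monoid \<and> properfactor x y}"
      unfolding wf_iff_no_infinite_down_chain
    proof
      assume "\<exists>a. \<forall>n. (a (Suc n), a n) \<in> {(x, y). x \<in> carrier (mk_monoid :: 'a monoid) \<and>
        y \<in> carrier mk_monoid \<and> properfactor x y}"
      then obtain a :: "nat \<Rightarrow> 'a" where "\<And>n. a n \<noteq> 0 \<and> properfactor (a (Suc n)) (a n)"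
        by auto
      then have "\<And>n. a (Suc n) dvd a n" "\<And>n. \<not> a n dvd a (Suc n)"
        using properfactor_nz by metis+
      with no_infinite_proper_divisor_chain[of a] show False by blast
    qed
  qed
  moreover have "primeness_condition_monoid (mk_monoid :: 'a monoid)"
  proof
    fix p :: 'a
    assume p: "p \<in> carrier mk_monoid" "irred p"
    then have "prime_elem p" by (simp add: irreducible_imp_prime_elem_pid)
    with p show "Divisibility.prime (mk_monoid :: 'a monoid) p"
      by (auto simp: Divisibility.prime_def prime_elem_def)
  qed
  ultimately show ?thesis
    using factorial_condition_one by blast
qed

text \<open>With this instance Gauss's theorem makes the polynomial ring factorial too, so that the
  irreducible \<open>g i\<close> are prime there.\<close>

instance principal_ideal_domain \<subseteq> ufd
  by (intro ufd.intro_of_class factorial_monoid_imp_ufd factorial_monoid_pid)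

section \<open>Factors of a product of primes\<close>

text \<open>Each prime \<open>g k\<close> divides \<open>A\<close> or \<open>B\<close>; it is
  cancelled from that factor and \<open>k\<close> is assigned to it. The cofactors \<open>A'\<close>
  and \<open>B'\<close> collect what remains of \<open>c\<close>.\<close>

lemma mult_eq_mult_prod_primes:
  fixes A B c :: "'a::idom"
  assumes "finite I" and "\<And>i. i \<in> I \<Longrightarrow> prime_elem (g i)" and "A * B = c * (\<Prod>i\<in>I. g i)"
  shows "\<exists>J A' B'. J \<subseteq> I \<and> A = A' * (\<Prod>i\<in>J. g i) \<and> B = B' * (\<Prod>i\<in>I-J. g i) \<and> A' * B' = c"
  using assms
proof (induction I arbitrary: A B rule: finite_induct)
  case empty
  then show ?case by auto
next
  case (insert k I)
  have prime: "prime_elem (g k)" using insert.prems by simp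
  then have nz: "g k \<noteq> 0" by simp
  have eq: "A * B = g k * (c * (\<Prod>i\<in>I. g i))"
    using insert by (simp add: ac_simps)
  then have "g k dvd A \<or> g k dvd B"
    using prime by (metis dvd_triv_left prime_elem_dvd_mult_iff)
  then show ?case
  proof
    assume "g k dvd A"
    then obtain A1 where A1: "A = g k * A1" by (elim dvdE)
    with eq nz have "A1 * B = c * (\<Prod>i\<in>I. g i)" by (simp add: mult.assoc)
    then obtain J A' B' where J: "J \<subseteq> I" "A1 = A' * (\<Prod>i\<in>J. g i)"
      "B = B' * (\<Prod>i\<in>I-J. g i)" "A' * B' = c"
      using insert.IH[of A1 B] insert.prems by auto
    have "finite J" "k \<notin> J" "insert k I - insert k J = I - J"
      using J(1) insert.hyps by (auto intro: finite_subset)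
    then have "insert k J \<subseteq> insert k I \<and> A = A' * (\<Prod>i\<in>insert k J. g i) \<and>
        B = B' * (\<Prod>i\<in>insert k I - insert k J. g i) \<and> A' * B' = c"
      using J A1 by (auto simp: ac_simps)
    then show ?thesis by blast
  next
    assume "g k dvd B"
    then obtain B1 where B1: "B = g k * B1" by (elim dvdE)
    with eq nz have "A * B1 = c * (\<Prod>i\<in>I. g i)" by (simp add: ac_simps)
    then obtain J A' B' where J: "J \<subseteq> I" "A = A' * (\<Prod>i\<in>J. g i)"
      "B1 = B' * (\<Prod>i\<in>I-J. g i)" "A' * B' = c"
      using insert.IH[of A B1] insert.prems by auto
    have "finite (I - J)" "k \<notin> I - J" "insert k I - J = insert k (I - J)"
      using J(1) insert.hyps by auto
    then have "J \<subseteq> insert k I \<and> A = A' * (\<Prod>i\<in>J. g i) \<and>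
        B = B' * (\<Prod>i\<in>insert k I - J. g i) \<and> A' * B' = c"
      using J B1 by (auto simp: ac_simps)
    then show ?thesis by blast
  qed
qed

text \<open>Induction on the coefficients, multiplying up their denominators.\<close>

lemma fract_poly_clear_denominator:
  fixes q :: "'a::idom fract poly"
  obtains d r where "d \<noteq> 0" and "smult (to_fract d) q = fract_poly r"
proof -
  have "\<exists>d r. d \<noteq> 0 \<and> smult (to_fract d) q = fract_poly r"
  proof (induction q)
    case 0
    then show ?case by (intro exI[of _ 1] exI[of _ 0]) auto
  next
    case (pCons a q)
    obtain d r where d: "d \<noteq> 0" "smult (to_fract d) q = fract_poly r"
      using pCons.IH by auto
    obtain u v where a: "a = Fract u v" "v \<noteq> 0" by (cases a)
    then have va: "to_fract v * a = to_fract u"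
      by (simp add: to_fract_def eq_fract)
    have "smult (to_fract v * to_fract d) (pCons a q) =
        pCons (to_fract d * (to_fract v * a)) (smult (to_fract v) (smult (to_fract d) q))"
      by (simp add: ac_simps)
    also have "\<dots> = fract_poly (pCons (d * u) (smult v r))"
      by (simp only: va d(2)) (simp add: to_fract_hom.map_poly_pCons_hom)
    finally have "smult (to_fract (v * d)) (pCons a q) = fract_poly (pCons (d * u) (smult v r))"
      by simp
    moreover have "v * d \<noteq> 0" using a d by simp
    ultimately show ?case by blast
  qed
  then show ?thesis using that by blast
qed

lemma smult_eq_smult_imp:
  fixes p q :: "'a::field poly"
  assumes "smult c p = smult d q" and "c \<noteq> 0"
  shows "p = smult (inverse c * d) q"
proof -
  have "p = smult (inverse c) (smult c p)" using assms(2) by simp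
  then show ?thesis unfolding assms(1) by simp
qed

text \<open>The previous splitting is carried over to the quotient field: clear all denominators,
  split in the polynomial ring over the domain, and divide back.\<close>

lemma fract_poly_mult_eq_prod_primes:
  fixes f1 f2 :: "'a::idom fract poly"
  assumes fin: "finite I" and prime: "\<And>i. i \<in> I \<Longrightarrow> prime_elem (g i)"
    and "f1 * f2 = smult c (fract_poly (\<Prod>i\<in>I. g i))" and "c \<noteq> 0"
  obtains J c1 c2 where "J \<subseteq> I" and "f1 = smult c1 (fract_poly (\<Prod>i\<in>J. g i))"
    and "f2 = smult c2 (fract_poly (\<Prod>i\<in>I-J. g i))"
proof -
  let ?G = "\<Prod>i\<in>I. g i"
  obtain d1 r1 where r1: "d1 \<noteq> 0" "smult (to_fract d1) f1 = fract_poly r1"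
    by (rule fract_poly_clear_denominator)
  obtain d2 r2 where r2: "d2 \<noteq> 0" "smult (to_fract d2) f2 = fract_poly r2"
    by (rule fract_poly_clear_denominator)
  obtain u v where uv: "c = Fract u v" "v \<noteq> 0" by (cases c)
  then have vc: "to_fract v * c = to_fract u"
    by (simp add: to_fract_def eq_fract)
  with uv \<open>c \<noteq> 0\<close> have "u \<noteq> 0" by auto
  \<comment> \<open>The denominator \<open>v\<close> of \<open>c\<close> is absorbed into the first
    factor, so that both sides have coefficients in the domain.\<close>
  have "fract_poly (smult v r1 * r2) = smult (to_fract v) (fract_poly r1 * fract_poly r2)"
    by simp
  also have "\<dots> = smult (to_fract v * to_fract d1 * to_fract d2) (f1 * f2)"
    by (simp add: ac_simps flip: r1 r2)
  also have "\<dots> = smult (to_fract d1 * to_fract d2 * (to_fract v * c)) (fract_poly ?G)"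
    using assms(3) by (simp add: ac_simps)
  also have "\<dots> = fract_poly ([:d1 * d2 * u:] * ?G)"
    by (simp add: vc)
  finally have vr: "smult v r1 * r2 = [:d1 * d2 * u:] * ?G"
    by (simp only: fract_poly_eq_iff)
  from mult_eq_mult_prod_primes[OF fin prime vr] obtain J A B where J: "J \<subseteq> I"
    and A: "smult v r1 = A * (\<Prod>i\<in>J. g i)" and B: "r2 = B * (\<Prod>i\<in>I-J. g i)"
    and AB: "A * B = [:d1 * d2 * u:]" by auto
  \<comment> \<open>A non-zero constant product over a domain has constant factors, because degrees
    add.\<close>
  have "A * B \<noteq> 0" using AB r1 r2 \<open>u \<noteq> 0\<close> by simp
  then have "A \<noteq> 0" "B \<noteq> 0" by auto
  then have "degree A + degree B = 0"
    using AB degree_mult_eq[of A B] by simp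
  then obtain a b where ab: "A = [:a:]" "B = [:b:]"
    by (metis add_is_0 degree_eq_zeroE)
  have "smult (to_fract (v * d1)) f1 = smult (to_fract a) (fract_poly (\<Prod>i\<in>J. g i))"
  proof -
    have "smult (to_fract (v * d1)) f1 = fract_poly (smult v r1)"
      using r1 by (simp flip: smult_smult)
    then show ?thesis unfolding A ab by simp
  qed
  moreover have "to_fract (v * d1) \<noteq> 0" using uv r1 by simp
  ultimately have 1: "f1 = smult (inverse (to_fract (v * d1)) * to_fract a) (fract_poly (\<Prod>i\<in>J. g i))"
    by (rule smult_eq_smult_imp)
  have "smult (to_fract d2) f2 = smult (to_fract b) (fract_poly (\<Prod>i\<in>I-J. g i))"
    unfolding r2 B ab by simp
  moreover have "to_fract d2 \<noteq> 0" using r2 by simp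
  ultimately have 2: "f2 = smult (inverse (to_fract d2) * to_fract b) (fract_poly (\<Prod>i\<in>I-J. g i))"
    by (rule smult_eq_smult_imp)
  from J 1 2 show ?thesis by (rule that)
qed

section \<open>Image-primitive polynomials\<close>

text \<open>This is how image-primitivity is exploited: to prove a property of 1, show that it
  defines an ideal and holds for every value of \<open>f\<close>.\<close>

lemma one_mem_ideal_of_values:
  assumes "fixed_divisor f = UNIV" and "is_ideal J"
    and "\<And>d w. to_fract d = poly f (to_fract w) \<Longrightarrow> d \<in> J"
  shows "1 \<in> J"
  using ideal_generated_subset[of "{d. \<exists>w. to_fract d = poly f (to_fract w)}" J] assms
  unfolding fixed_divisor_def by auto

lemma poly_fract_poly: "poly (fract_poly p) (to_fract w) = to_fract (poly p w)"
  by (simp add: to_fract_hom.poly_map_poly)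

text \<open>The values of an image-primitive product \<open>c * h * f2\<close> lie in the ideal of all \<open>d\<close>
  with \<open>d / c\<close> in the ring, so \<open>1 / c\<close> is in the ring.\<close>

lemma image_primitive_factor_cofactor:
  fixes f2 :: "'a::idom fract poly"
  assumes "fixed_divisor (smult c (fract_poly h) * f2) = UNIV" and "f2 \<in> int_valued"
  obtains b where "c * to_fract b = 1"
proof -
  let ?J = "{d. \<exists>e. to_fract d = c * to_fract e}"
  have "1 \<in> ?J"
    using assms(1)
  proof (rule one_mem_ideal_of_values)
    show "is_ideal ?J"
    proof (rule is_idealI)
      show "0 \<in> ?J" by (auto intro: exI[of _ 0])
    next
      fix x y assume "x \<in> ?J" "y \<in> ?J"
      then obtain e e' where "to_fract x = c * to_fract e" "to_fract y = c * to_fract e'" by auto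
      then have "to_fract (x + y) = c * to_fract (e + e')" by (simp add: algebra_simps)
      then show "x + y \<in> ?J" by blast
    next
      fix r x assume "x \<in> ?J"
      then obtain e where "to_fract x = c * to_fract e" by auto
      then have "to_fract (r * x) = c * to_fract (r * e)" by (simp add: algebra_simps)
      then show "r * x \<in> ?J" by blast
    qed
  next
    fix d w assume d: "to_fract d = poly (smult c (fract_poly h) * f2) (to_fract w)"
    obtain e where "poly f2 (to_fract w) = to_fract e"
      using assms(2) by (auto simp: int_valued_def)
    with d have "to_fract d = c * to_fract (poly h w * e)"
      by (simp add: poly_fract_poly)
    then show "d \<in> ?J" by blast
  qed
  then show ?thesis using that by auto
qed

lemma dvd_poly_values:
  fixes f :: "'a::idom fract poly"
  assumes "f \<in> int_valued" and "smult (to_fract b) f = fract_poly h"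
  shows "b dvd poly h w"
proof -
  obtain e where e: "poly f (to_fract w) = to_fract e"
    using assms(1) by (auto simp: int_valued_def)
  have "to_fract (poly h w) = to_fract (b * e)"
    using arg_cong[OF assms(2), of "\<lambda>q. poly q (to_fract w)"] e by (simp add: poly_fract_poly)
  then have "poly h w = b * e" by (simp only: to_fract_eq_iff)
  then show ?thesis by simp
qed

text \<open>Every value \<open>d\<close> of \<open>f\<close> satisfies b * d = h(w), a multiple of
  \<open>p\<close>. Hence all values lie in the ideal of those \<open>d\<close> with p | b * d, and
  so does 1.\<close>

lemma dvd_fixed_divisor_imp_dvd_denominator:
  fixes f :: "'a::idom fract poly"
  assumes "fixed_divisor f = UNIV" and eq: "smult (to_fract b) f = fract_poly h"
    and p: "\<forall>c \<in> fixed_divisor (fract_poly h). p dvd c"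
  shows "p dvd b"
proof -
  have "1 \<in> {d. p dvd b * d}"
    using assms(1)
  proof (rule one_mem_ideal_of_values)
    show "is_ideal {d. p dvd b * d}"
      by (auto intro!: is_idealI simp: algebra_simps)
  next
    fix d w assume d: "to_fract d = poly f (to_fract w)"
    have "to_fract (b * d) = to_fract (poly h w)"
      using arg_cong[OF eq, of "\<lambda>q. poly q (to_fract w)"] d by (simp add: poly_fract_poly)
    then have "b * d = poly h w" by (simp only: to_fract_eq_iff)
    moreover have "poly h w \<in> fixed_divisor (fract_poly h)"
      unfolding fixed_divisor_def using ideal_generated_superset by (force simp: poly_fract_poly)
    ultimately show "d \<in> {d. p dvd b * d}" using p by auto
  qed
  then show ?thesis by simp
qed

section \<open>Essential polynomials\<close>

lemma valuation_eq_0_imp_not_dvd: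
  assumes "valuation p x = 0"
  shows "\<not> p dvd x"
proof
  assume "p dvd x"
  \<comment> \<open>The exponent 1 is among those over which the supremum is taken.\<close>
  then have "enat 1 \<le> valuation p x"
    unfolding valuation_def by (intro SUP_upper) simp
  with assms show False by (simp add: enat_0_iff zero_enat_def)
qed

lemma prime_elem_dvd_prod:
  assumes "prime_elem p" and "finite J" and "p dvd (\<Prod>i\<in>J. h i)"
  shows "\<exists>i\<in>J. p dvd h i"
  using assms(2,3)
proof (induction rule: finite_induct)
  case empty
  then show ?case using assms(1) by (simp add: prime_elem_def)
next
  case (insert k J)
  then have "p dvd h k * (\<Prod>i\<in>J. h i)" by simp
  then have "p dvd h k \<or> p dvd (\<Prod>i\<in>J. h i)"
    by (rule prime_elem_dvd_multD[OF assms(1)])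
  then show ?case using insert.IH by auto
qed

text \<open>A witness for an index outside \<open>J\<close> is a point at which no factor in \<open>J\<close> is divisible
  by \<open>p\<close>.\<close>

lemma essential_imp_not_dvd_prod:
  assumes "prime_elem p" and "essential p I g j" and "J \<subseteq> I" and "j \<notin> J" and "finite I"
  obtains w where "\<not> p dvd poly (\<Prod>i\<in>J. g i) w"
proof -
  obtain w where w: "\<forall>i \<in> I - {j}. valuation p (poly (g i) w) = 0"
    using assms(2) by (auto simp: essential_def)
  have "\<not> p dvd poly (g i) w" if "i \<in> J" for i
  proof (rule valuation_eq_0_imp_not_dvd)
    have "i \<in> I - {j}" using that assms(3,4) by auto
    with w show "valuation p (poly (g i) w) = 0" by (rule bspec)
  qed
  moreover have "finite J" by (rule finite_subset[OF assms(3,5)])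
  ultimately have "\<not> p dvd poly (\<Prod>i\<in>J. g i) w"
    unfolding poly_prod using prime_elem_dvd_prod[OF assms(1)] by metis
  then show ?thesis by (rule that)
qed

text \<open>A path from a vertex in \<open>J\<close> to one outside \<open>J\<close> has to leave
  \<open>J\<close> along some edge.\<close>

lemma connected_essential_graph_crossing_edge:
  assumes conn: "Digraph_Component.connected (essential_graph I g)"
    and "J \<subseteq> I" and "J \<noteq> {}" and "J \<noteq> I"
  obtains i j p where "i \<in> J" and "j \<in> I - J" and "prime_elem p"
    and "essential p I g i" and "essential p I g j"
proof -
  let ?G = "essential_graph I g"
  obtain u v where u: "u \<in> J" and v: "v \<in> I - J" using assms by auto
  have "u \<rightarrow>\<^sup>*\<^bsub>with_proj (mk_symmetric ?G)\<^esub> v"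
    using conn u v \<open>J \<subseteq> I\<close>
    by (auto simp: Digraph_Component.connected_def strongly_connected_def essential_graph_def)
  then have "(u, v) \<in> (parcs (mk_symmetric ?G))\<^sup>*"
    using reachable_rtranclI by fastforce
  \<comment> \<open>Invariant along the path: either its current end is still in \<open>J\<close>,
    or a crossing arc has occurred.\<close>
  then have "v \<in> J \<or> (\<exists>i\<in>J. \<exists>j. j \<notin> J \<and> (i, j) \<in> parcs (mk_symmetric ?G))"
    by (induction rule: rtrancl_induct) (use u in auto)
  then obtain i j where ij: "i \<in> J" "j \<notin> J" "(i, j) \<in> parcs (mk_symmetric ?G)"
    using v by auto
  \<comment> \<open>Connectedness refers to the symmetric closure, so the arc may be a reversed one;
    adjacency in the essential graph is symmetric, so both cases give the same prime.\<close>
  from ij(3) have "(i, j) \<in> parcs ?G \<or> (j, i) \<in> parcs ?G"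
    unfolding parcs_mk_symmetric by auto
  then have "j \<in> I \<and> (\<exists>p. prime_elem p \<and> essential p I g i \<and> essential p I g j)"
    unfolding essential_graph_def by (elim disjE) (simp_all, metis)
  then obtain p where "j \<in> I" "prime_elem p" "essential p I g i" "essential p I g j"
    by (elim conjE exE)
  then show ?thesis using ij(1,2) by (intro that[of i j p]) simp_all
qed

section \<open>Irreducibility\<close>

lemma unit_in_int_valued_const:
  assumes "smult c 1 \<in> (int_valued :: 'a::idom fract poly set)" and "c * to_fract b = 1"
  shows "unit_in int_valued (smult c 1 :: 'a fract poly)"
proof -
  have "smult c 1 * [:to_fract b:] = 1"
    using assms(2) by (simp add: mult.commute)
  moreover have "[:to_fract b:] \<in> int_valued"
    by (simp add: int_valued_def)
  ultimately show ?thesis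
    using assms(1) unfolding unit_in_def by metis
qed

theorem theorem1:
  fixes f :: "'a::principal_ideal_domain fract poly"
    and b :: 'a
    and I :: "'i set"
    and g :: "'i \<Rightarrow> 'a poly"
  assumes "f \<in> int_valued"
    and "degree f > 0"
    and "image_primitive f"
    and "finite I"
    and "\<And>i. i \<in> I \<Longrightarrow> primitive_poly (g i) \<and> irreducible (g i)"
    and "b \<noteq> 0"
    and "f = smult (Fract 1 b) (fract_poly (\<Prod>i\<in>I. g i))"
    and "Digraph_Component.connected (essential_graph I g)"
  shows "irreducible_in int_valued f"
  unfolding irreducible_in_def
proof (intro conjI)
  show "f \<in> int_valued" by fact
  show "f \<noteq> 0" using assms(2) by auto
  show "\<not> unit_in int_valued f"
  proof
    assume "unit_in int_valued f"
    then obtain h where "f * h = 1" by (auto simp: unit_in_def)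
    then have "f dvd 1" by (metis dvdI)
    then show False using assms(2) by (simp add: poly_dvd_1)
  qed
  show "\<not> (\<exists>f1\<in>int_valued. \<exists>f2\<in>int_valued.
    f = f1 * f2 \<and> \<not> unit_in int_valued f1 \<and> \<not> unit_in int_valued f2)"
  proof (rule notI, elim bexE conjE)
    fix f1 f2 :: "'a fract poly"
    assume f12: "f1 \<in> int_valued" "f2 \<in> int_valued" "f = f1 * f2"
      and nu: "\<not> unit_in int_valued f1" "\<not> unit_in int_valued f2"
    have fd: "fixed_divisor f = UNIV"
      using assms(3) by (simp add: image_primitive_def)
    have "prime_elem (g i)" if "i \<in> I" for i
      using assms(5)[OF that] by simp
    moreover have "f1 * f2 = smult (Fract 1 b) (fract_poly (\<Prod>i\<in>I. g i))"
      using assms(7) f12(3) by simp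
    moreover have "Fract 1 b \<noteq> 0"
      using assms(6) by (simp add: Zero_fract_def eq_fract)
    ultimately obtain J c1 c2 where J: "J \<subseteq> I"
      and f1: "f1 = smult c1 (fract_poly (\<Prod>i\<in>J. g i))"
      and f2: "f2 = smult c2 (fract_poly (\<Prod>i\<in>I-J. g i))"
      using fract_poly_mult_eq_prod_primes[OF assms(4)] by metis
    \<comment> \<open>The other factor, being integer-valued, serves as the cofactor; the same is
      done below with the roles exchanged.\<close>
    obtain b1 where b1: "c1 * to_fract b1 = 1"
      using image_primitive_factor_cofactor[of c1 _ f2] fd f12 f1 by metis
    obtain b2 where b2: "c2 * to_fract b2 = 1"
      using image_primitive_factor_cofactor[of c2 _ f1] fd f12 f2 by (metis mult.commute)
    \<comment> \<open>Over an empty index set the product is 1, which leaves \<open>f1\<close> as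
      the constant \<open>c1\<close> with inverse \<open>b1\<close> in the ring.\<close>
    have "J \<noteq> {}"
      using unit_in_int_valued_const[of c1 b1] b1 f1 f12(1) nu(1) by auto
    moreover have "J \<noteq> I"
      using unit_in_int_valued_const[of c2 b2] b2 f2 f12(2) nu(2) by auto
    ultimately obtain i j p where ij: "i \<in> J" "j \<in> I - J" and p: "prime_elem p"
      and ess: "essential p I g i" "essential p I g j"
      using connected_essential_graph_crossing_edge[OF assms(8) J] by metis
    have e1: "smult (to_fract b1) f1 = fract_poly (\<Prod>i\<in>J. g i)"
      and e2: "smult (to_fract b2) f2 = fract_poly (\<Prod>i\<in>I-J. g i)"
      using b1 b2 by (simp_all add: f1 f2 mult.commute)
    \<comment> \<open>Thus \<open>b1 * b2\<close> is a denominator of \<open>f\<close> for the full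
      product as numerator, to which divisibility of the fixed divisor by \<open>p\<close>
      applies.\<close>
    have "smult (to_fract (b1 * b2)) f = smult (to_fract b1) f1 * smult (to_fract b2) f2"
      by (simp add: f12(3) ac_simps)
    also have "\<dots> = fract_poly ((\<Prod>i\<in>J. g i) * (\<Prod>i\<in>I-J. g i))"
      by (simp only: e1 e2 fract_poly_mult)
    also have "(\<Prod>i\<in>J. g i) * (\<Prod>i\<in>I-J. g i) = (\<Prod>i\<in>I. g i)"
      using prod.subset_diff[OF J assms(4), of g] by (simp add: mult.commute)
    finally have "p dvd b1 * b2"
      by (rule dvd_fixed_divisor_imp_dvd_denominator[OF fd]) (use ess(1) in \<open>unfold essential_def, blast\<close>)
    then consider "p dvd b1" | "p dvd b2"
      using prime_elem_dvd_mult_iff[OF p] by blast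
    then show False
    proof cases
      case 1
      \<comment> \<open>The witness comes from the endpoint \<open>j\<close> outside
        \<open>J\<close>; in the other case it comes from \<open>i\<close>, which lies outside
        \<open>I - J\<close>.\<close>
      obtain w where "\<not> p dvd poly (\<Prod>i\<in>J. g i) w"
        by (rule essential_imp_not_dvd_prod[OF p ess(2) J]) (use ij assms(4) in auto)
      then show False using 1 dvd_poly_values[OF f12(1) e1] dvd_trans by blast
    next
      case 2
      obtain w where "\<not> p dvd poly (\<Prod>i\<in>I-J. g i) w"
        by (rule essential_imp_not_dvd_prod[OF p ess(1), of "I - J"]) (use ij assms(4) in auto)
      then show False using 2 dvd_poly_values[OF f12(2) e2] dvd_trans by blast
    qed
  qed
qed

end
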